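(* Let $\delta\in\mathbb C^\times$ and let $\mathcal A$ be a (not necessarily associative) complex algebra with $\dim\mathcal A\le4$. Then $\mathcal A$ is a $\delta$-mock-Novikov algebra if and only if $\mathcal A^2\subseteq\operatorname{Ann}(\mathcal A)$.
   Context: An algebra is a vector space with a bilinear product, written by juxtaposition. A $\delta$-mock-Novikov algebra is an algebra $\mathcal A$ such that for all $a,b,c\in\mathcal A$ $$\delta(ab)c+\delta(ba)c+a(bc)+b(ac)=0,\qquad (ab)c+(ac)b=0.$$ $\mathcal A^2$ is the linear span of all products $ab$ with $a,b\in\mathcal A$, and $\operatorname{Ann}(\mathcal A)=\{x\in\mathcal A\mid x\mathcal A=\mathcal Ax=0\}$. *)

theory Defs
  imports Complex_Main
begin

(* The algebra is carried by a whole type. No associativity, commutativity or unit is assumed. *)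
locale nonassoc_algebra = vector_space scale
  for scale :: "'k::field \<Rightarrow> 'a::ab_group_add \<Rightarrow> 'a" (infixr "*s" 75) +
  fixes mult :: "'a \<Rightarrow> 'a \<Rightarrow> 'a" (infixl "\<cdot>" 70)
  assumes linear_mult_left: "Vector_Spaces.linear scale scale (\<lambda>x. x \<cdot> y)"
    and linear_mult_right: "Vector_Spaces.linear scale scale (\<lambda>y. x \<cdot> y)"
begin

definition mock_novikov :: "'k \<Rightarrow> bool" where
  "mock_novikov \<delta> \<longleftrightarrow>
     (\<forall>a b c. \<delta> *s ((a \<cdot> b) \<cdot> c) + \<delta> *s ((b \<cdot> a) \<cdot> c) + a \<cdot> (b \<cdot> c) + b \<cdot> (a \<cdot> c) = 0) \<and>
     (\<forall>a b c. (a \<cdot> b) \<cdot> c + (a \<cdot> c) \<cdot> b = 0)"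

definition square :: "'a set" where
  "square = span {a \<cdot> b | a b. True}"

definition annihilator :: "'a set" where
  "annihilator = {x. \<forall>a. x \<cdot> a = 0 \<and> a \<cdot> x = 0}"

end

end

theory Submission
  imports Defs
begin

text \<open>
  Write \<open>R\<^sub>x\<close> and \<open>L\<^sub>x\<close> for right and left multiplication by \<open>x\<close>. In a mock-Novikov algebra the
  operators \<open>R\<^sub>x\<close> anticommute. If \<open>e = (ab)c \<noteq> 0\<close>, then \<open>a\<close> generates a free module over the
  exterior algebra on \<open>R\<^sub>b\<close> and \<open>R\<^sub>c\<close>, so \<open>a, ab, ac, e\<close> are a basis in dimension four. Every \<open>R\<^sub>x\<close> is
  determined by \<open>ax\<close>, which has no \<open>a\<close>-component, and the first identity then puts
  \<open>a(ab), a(ac), ae\<close> on the line of \<open>e\<close>. Hence modulo \<open>e\<close> both \<open>ab\<close> and \<open>ac\<close> are multiples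
  of \<open>aa\<close>, contradicting their independence. So \<open>(ab)c = 0\<close> identically, and now the operators
  \<open>L\<^sub>x\<close> anticommute; if \<open>a(bc) \<noteq> 0\<close>, then the five vectors \<open>a, b, ac, bc, a(bc)\<close> are independent.
\<close>

text \<open>Phrased for an indexed family, so that uses need no distinctness of the vectors: a
  repetition gives a relation with coefficients 1 and -1.\<close>

lemma (in finite_dimensional_vector_space) ex_relation_if_dim_less_card:
  assumes "finite I" and "dim UNIV < card I"
  shows "\<exists>g. (\<exists>i\<in>I. g i \<noteq> 0) \<and> (\<Sum>i\<in>I. g i *s f i) = 0"
proof (cases "inj_on f I")
  case True
  have "dependent (f ` I)"
  proof (rule ccontr)
    assume "\<not> dependent (f ` I)"
    then have "card (f ` I) \<le> dim UNIV"
      by (intro independent_card_le_dim) auto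
    then show False using card_image[OF True] assms(2) by simp
  qed
  then obtain h v where h: "v \<in> f ` I" "h v \<noteq> 0" "(\<Sum>v\<in>f ` I. h v *s v) = 0"
    using dependent_finite[of "f ` I"] assms(1) by auto
  then have "(\<Sum>i\<in>I. h (f i) *s f i) = 0"
    using sum.reindex[OF True, of "\<lambda>v. h v *s v"] by (simp add: o_def)
  then show ?thesis using h by (intro exI[of _ "h \<circ> f"]) auto
next
  case False
  then obtain i j where ij: "i \<in> I" "j \<in> I" "i \<noteq> j" "f i = f j"
    by (auto simp: inj_on_def)
  define g where "g = (\<lambda>k. if k = i then 1 else if k = j then - 1 else 0 :: 'a)"
  have "(\<Sum>k\<in>I. g k *s f k) = (\<Sum>k\<in>{i, j}. g k *s f k)"
    using ij assms(1) by (intro sum.mono_neutral_right) (auto simp: g_def)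
  also have "\<dots> = 0" using ij by (simp add: g_def)
  finally show ?thesis using ij by (intro exI[of _ g]) (auto simp: g_def)
qed

lemma (in finite_dimensional_vector_space) five_vectors_relation:
  assumes "dim UNIV \<le> 4"
  obtains k1 k2 k3 k4 k5
  where "k1 *s x1 + k2 *s x2 + k3 *s x3 + k4 *s x4 + k5 *s x5 = 0"
    and "\<not> (k1 = 0 \<and> k2 = 0 \<and> k3 = 0 \<and> k4 = 0 \<and> k5 = 0)"
proof -
  have "\<exists>g. (\<exists>i\<in>{..<5}. g i \<noteq> 0) \<and> (\<Sum>i<5. g i *s ([x1, x2, x3, x4, x5] ! i)) = 0"
    using assms by (intro ex_relation_if_dim_less_card) auto
  then obtain g i where g: "i < (5::nat)" "g i \<noteq> 0"
    "(\<Sum>i<5. g i *s ([x1, x2, x3, x4, x5] ! i)) = 0" by auto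
  from g(1) have "i = 0 \<or> i = 1 \<or> i = 2 \<or> i = 3 \<or> i = 4" by arith
  with g(2,3) show ?thesis
    by (intro that[of "g 0" "g 1" "g 2" "g 3" "g 4"]) (auto simp: eval_nat_numeral)
qed

context nonassoc_algebra
begin

sublocale left: Vector_Spaces.linear scale scale "\<lambda>x. x \<cdot> y" for y
  by (rule linear_mult_left)

sublocale right: Vector_Spaces.linear scale scale "\<lambda>y. x \<cdot> y" for x
  by (rule linear_mult_right)

lemmas mult_simps =
  left.add left.scale left.zero left.neg left.diff
  right.add right.scale right.zero right.neg right.diff

lemma add_self_eq_zero_imp_zero:
  fixes x :: 'a
  assumes "(2::'k) \<noteq> 0" and "x + x = 0"
  shows "x = 0"
proof -
  have "2 *s x = x + x" using scale_left_distrib[of 1 1 x] by simp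
  then show ?thesis using assms by simp
qed

text \<open>The annihilator is a subspace, so testing it on products is enough.\<close>

lemma square_subset_annihilator_iff:
  "square \<subseteq> annihilator \<longleftrightarrow> (\<forall>a b c. (a \<cdot> b) \<cdot> c = 0 \<and> a \<cdot> (b \<cdot> c) = 0)"
proof
  assume "square \<subseteq> annihilator"
  moreover have "a \<cdot> b \<in> square" for a b
    unfolding square_def by (rule span_base) auto
  ultimately show "\<forall>a b c. (a \<cdot> b) \<cdot> c = 0 \<and> a \<cdot> (b \<cdot> c) = 0"
    by (fastforce simp: annihilator_def)
next
  assume "\<forall>a b c. (a \<cdot> b) \<cdot> c = 0 \<and> a \<cdot> (b \<cdot> c) = 0"
  moreover have "subspace annihilator"
    by (rule subspaceI) (auto simp: annihilator_def mult_simps)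
  ultimately show "square \<subseteq> annihilator"
    unfolding square_def by (intro span_minimal) (auto simp: annihilator_def)
qed

end

locale finite_dimensional_nonassoc_algebra =
  nonassoc_algebra scale mult + finite_dimensional_vector_space scale Basis
  for scale :: "'k::field \<Rightarrow> 'a::ab_group_add \<Rightarrow> 'a" (infixr "*s" 75)
    and mult :: "'a \<Rightarrow> 'a \<Rightarrow> 'a" (infixl "\<cdot>" 70)
    and Basis :: "'a set"
begin

lemma left_triple_product_zero:
  assumes char: "(2::'k) \<noteq> 0" and dim: "dim UNIV \<le> 4" and mock: "mock_novikov \<delta>"
  shows "(a \<cdot> b) \<cdot> c = 0"
proof (rule ccontr)
  have anti: "(x \<cdot> y) \<cdot> z = - ((x \<cdot> z) \<cdot> y)" for x y z
    using mock by (auto simp: mock_novikov_def eq_neg_iff_add_eq_0)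
  have alt: "(x \<cdot> y) \<cdot> y = 0" for x y
    by (rule add_self_eq_zero_imp_zero[OF char]) (use mock in \<open>auto simp: mock_novikov_def\<close>)
  have main: "\<delta> *s ((x \<cdot> y) \<cdot> z) + \<delta> *s ((y \<cdot> x) \<cdot> z) + x \<cdot> (y \<cdot> z) + y \<cdot> (x \<cdot> z) = 0" for x y z
    using mock by (auto simp: mock_novikov_def)
  define u v e where "u = a \<cdot> b" and "v = a \<cdot> c" and "e = u \<cdot> c"
  assume "(a \<cdot> b) \<cdot> c \<noteq> 0"
  then have e0: "e \<noteq> 0" by (simp add: e_def u_def)
  have ab: "a \<cdot> b = u" and ac: "a \<cdot> c = v" and uc: "u \<cdot> c = e"
    by (simp_all add: u_def v_def e_def)
  have ub: "u \<cdot> b = 0" and vc: "v \<cdot> c = 0" by (simp_all add: u_def v_def alt)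
  have vb: "v \<cdot> b = - e" using anti[of a c b] by (simp add: ab ac uc)
  have ec: "e \<cdot> c = 0" by (simp add: e_def alt)
  have eb: "e \<cdot> b = 0" using anti[of u c b] by (simp add: ub uc mult_simps)
  note tab = ab ac uc ub vc vb ec eb

  \<comment> \<open>Multiplying the relation by \<open>b\<close> and then \<open>c\<close> leaves
    only \<open>k1 *s e\<close>; after that \<open>c\<close> alone isolates \<open>k2\<close>, and
    \<open>b\<close> alone isolates \<open>k3\<close>.\<close>
  have indep: "k1 = 0 \<and> k2 = 0 \<and> k3 = 0 \<and> k4 = 0"
    if z: "k1 *s a + k2 *s u + k3 *s v + k4 *s e = 0" for k1 k2 k3 k4
  proof -
    have "((k1 *s a + k2 *s u + k3 *s v + k4 *s e) \<cdot> b) \<cdot> c = 0"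
      by (simp only: z mult_simps)
    then have k1: "k1 = 0" using e0 by (simp add: mult_simps tab)
    have "(k1 *s a + k2 *s u + k3 *s v + k4 *s e) \<cdot> c = 0"
      by (simp only: z mult_simps)
    then have k2: "k2 = 0" using e0 k1 by (simp add: mult_simps tab)
    have "(k1 *s a + k2 *s u + k3 *s v + k4 *s e) \<cdot> b = 0"
      by (simp only: z mult_simps)
    then have k3: "k3 = 0" using e0 k1 k2 by (simp add: mult_simps tab)
    show ?thesis using z e0 k1 k2 k3 by simp
  qed

  have spanning: "\<exists>k1 k2 k3 k4. x = k1 *s a + k2 *s u + k3 *s v + k4 *s e" for x
  proof -
    obtain k1 k2 k3 k4 k5
      where k: "k1 *s a + k2 *s u + k3 *s v + k4 *s e + k5 *s x = 0"
        and nz: "\<not> (k1 = 0 \<and> k2 = 0 \<and> k3 = 0 \<and> k4 = 0 \<and> k5 = 0)"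
      using five_vectors_relation[OF dim, of a u v e x] by metis
    have k5: "k5 \<noteq> 0" using indep[of k1 k2 k3 k4] k nz by auto
    have "k5 *s x = - (k1 *s a + k2 *s u + k3 *s v + k4 *s e)"
      using k by (metis eq_neg_iff_add_eq_0 add.commute)
    then have "inverse k5 *s (k5 *s x) = inverse k5 *s (- (k1 *s a + k2 *s u + k3 *s v + k4 *s e))"
      by simp
    then have "x = (- inverse k5 * k1) *s a + (- inverse k5 * k2) *s u
        + (- inverse k5 * k3) *s v + (- inverse k5 * k4) *s e"
      using k5 by (simp add: scale_right_distrib scale_right_diff_distrib)
    then show ?thesis by blast
  qed

  have right_mult: "\<exists>p q r. a \<cdot> x = p *s u + q *s v + r *s e \<and> u \<cdot> x = q *s e
      \<and> v \<cdot> x = (- p) *s e \<and> e \<cdot> x = 0" for x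
  proof -
    \<comment> \<open>The \<open>a\<close>-component \<open>s\<close> is an eigenvalue: moving right
      multiplication by \<open>x\<close> past those by \<open>c\<close> and \<open>b\<close> costs
      two signs, so \<open>e \<cdot> x = s *s e\<close>. Multiplying by \<open>x\<close> twice gives
      zero, which forces \<open>s = 0\<close>.\<close>
    obtain s p q r where ax: "a \<cdot> x = s *s a + p *s u + q *s v + r *s e"
      using spanning by blast
    have "e \<cdot> x = - ((u \<cdot> x) \<cdot> c)" using anti[of u c x] by (simp add: uc)
    also have "u \<cdot> x = - ((a \<cdot> x) \<cdot> b)" using anti[of a b x] by (simp add: ab)
    finally have ex: "e \<cdot> x = s *s e" by (simp add: ax mult_simps tab)
    have "s *s s *s e = 0" using alt[of e x] by (simp add: ex mult_simps)
    then have s: "s = 0" using e0 by simp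
    have "u \<cdot> x = q *s e"
      using anti[of a b x] by (simp add: ax s ab mult_simps tab)
    moreover have "v \<cdot> x = (- p) *s e"
      using anti[of a c x] by (simp add: ax s ac mult_simps tab)
    ultimately show ?thesis using ax ex s by auto
  qed

  \<comment> \<open>Both \<open>u \<cdot> v\<close> and \<open>v \<cdot> u\<close> lie on the line
    of \<open>e\<close>, which \<open>b\<close> and \<open>c\<close> kill from the right. So the
    \<delta>-terms of the first identity at \<open>u\<close>, \<open>v\<close>, \<open>b\<close>
    vanish, leaving \<open>u \<cdot> (v \<cdot> b) = - (u \<cdot> e)\<close>. With \<open>c\<close>
    as third argument, \<open>v \<cdot> e\<close> is left.\<close>
  have ue: "u \<cdot> e = 0"
  proof -
    obtain k where "u \<cdot> v = k *s e" using right_mult by blast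
    moreover obtain l where "v \<cdot> u = l *s e" using right_mult by blast
    ultimately show ?thesis using main[of u v b] by (simp add: tab mult_simps)
  qed
  have ve: "v \<cdot> e = 0"
  proof -
    obtain k where "u \<cdot> v = k *s e" using right_mult by blast
    moreover obtain l where "v \<cdot> u = l *s e" using right_mult by blast
    ultimately show ?thesis using main[of u v c] by (simp add: tab mult_simps)
  qed
  \<comment> \<open>The \<open>u\<close>- and \<open>v\<close>-components of
    \<open>a \<cdot> e\<close> are, up to sign, the coefficients of \<open>v \<cdot> e\<close> and
    \<open>u \<cdot> e\<close>, both zero.\<close>
  have ae: "\<exists>k. a \<cdot> e = k *s e"
    using right_mult[of e] e0 by (auto simp: ue ve)
  \<comment> \<open>With equal first arguments the first identity is twice the desired
    relation.\<close>
  have left_sq: "a \<cdot> (a \<cdot> x) = - (\<delta> *s ((a \<cdot> a) \<cdot> x))" for x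
  proof -
    let ?s = "\<delta> *s ((a \<cdot> a) \<cdot> x) + a \<cdot> (a \<cdot> x)"
    have "?s + ?s = 0" using main[of a a x] by (simp add: algebra_simps)
    then have "?s = 0" by (rule add_self_eq_zero_imp_zero[OF char])
    then show ?thesis by (metis eq_neg_iff_add_eq_0 add.commute)
  qed
  obtain p q r where aa: "a \<cdot> a = p *s u + q *s v + r *s e" using right_mult by blast
  have au: "a \<cdot> u = (\<delta> * q) *s e"
    using left_sq[of b] by (simp add: aa tab mult_simps)
  have av: "a \<cdot> v = (- (\<delta> * p)) *s e"
    using left_sq[of c] by (simp add: aa tab mult_simps)
  have line: "\<exists>m k. a \<cdot> x = m *s (a \<cdot> a) + k *s e" for x
  proof -
    obtain k1 k2 k3 k4 where x: "x = k1 *s a + k2 *s u + k3 *s v + k4 *s e"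
      using spanning by blast
    obtain k where k: "a \<cdot> e = k *s e" using ae by blast
    have "a \<cdot> x = k1 *s (a \<cdot> a) + (k2 * (\<delta> * q) + k3 * (- (\<delta> * p)) + k4 * k) *s e"
      by (simp only: x mult_simps au av k scale_left_distrib scale_scale add.assoc)
    then show ?thesis by blast
  qed
  obtain m k where u: "u = m *s (a \<cdot> a) + k *s e" using line[of b] by (auto simp: ab)
  obtain n l where v: "v = n *s (a \<cdot> a) + l *s e" using line[of c] by (auto simp: ac)
  \<comment> \<open>Eliminating \<open>a \<cdot> a\<close> gives a relation among \<open>u\<close>,
    \<open>v\<close>, \<open>e\<close>; independence makes \<open>m\<close> zero, and then
    \<open>u\<close> is a multiple of \<open>e\<close>.\<close>
  have "n *s u - m *s v = (n * k - m * l) *s e"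
    by (subst u, subst v) (simp add: algebra_simps)
  then have "0 *s a + n *s u + (- m) *s v + (m * l - n * k) *s e = 0"
    by (simp add: algebra_simps)
  then have "m = 0" using indep[of 0 n "- m" "m * l - n * k"] by simp
  then have "0 *s a + 1 *s u + 0 *s v + (- k) *s e = 0" by (subst u) simp
  then show False using indep[of 0 1 0 "- k"] by simp
qed

lemma right_triple_product_zero:
  assumes left_zero: "\<And>x y z. (x \<cdot> y) \<cdot> z = 0"
    and char: "(2::'k) \<noteq> 0" and dim: "dim UNIV \<le> 4" and mock: "mock_novikov \<delta>"
  shows "a \<cdot> (b \<cdot> c) = 0"
proof (rule ccontr)
  assume nz: "a \<cdot> (b \<cdot> c) \<noteq> 0"
  \<comment> \<open>By \<open>left_zero\<close> both \<delta>-terms of the first identity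
    vanish.\<close>
  have anti: "x \<cdot> (y \<cdot> z) = - (y \<cdot> (x \<cdot> z))" for x y z
    using mock left_zero by (auto simp: mock_novikov_def eq_neg_iff_add_eq_0)
  have alt: "x \<cdot> (x \<cdot> z) = 0" for x z
    by (rule add_self_eq_zero_imp_zero[OF char])
      (use anti[of x x z] in \<open>simp only: eq_neg_iff_add_eq_0\<close>)
  define e where "e = a \<cdot> (b \<cdot> c)"
  have e0: "e \<noteq> 0" using nz by (simp add: e_def)
  have abc: "a \<cdot> (b \<cdot> c) = e" by (simp add: e_def)
  have bac: "b \<cdot> (a \<cdot> c) = - e" using anti[of b a c] by (simp add: e_def)
  have ae: "a \<cdot> e = 0" by (simp add: e_def alt)
  have be: "b \<cdot> e = 0" using anti[of b a "b \<cdot> c"] by (simp add: e_def alt mult_simps)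
  have ez: "e \<cdot> z = 0" for z by (simp add: e_def left_zero)
  note tab = abc bac ae be ez alt left_zero
  obtain k1 k2 k3 k4 k5
    where k: "k1 *s a + k2 *s b + k3 *s (a \<cdot> c) + k4 *s (b \<cdot> c) + k5 *s e = 0"
      and nz: "\<not> (k1 = 0 \<and> k2 = 0 \<and> k3 = 0 \<and> k4 = 0 \<and> k5 = 0)"
    using five_vectors_relation[OF dim, of a b "a \<cdot> c" "b \<cdot> c" e] by metis
  \<comment> \<open>Right multiplication by \<open>b \<cdot> c\<close> isolates \<open>k1\<close>,
    since \<open>left_zero\<close> kills the three products in \<open>?w\<close> and
    \<open>alt\<close> kills \<open>b \<cdot> (b \<cdot> c)\<close>; \<open>a \<cdot> c\<close>
    isolates \<open>k2\<close> likewise. Left multiplication by \<open>a\<close> and by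
    \<open>b\<close> then isolates \<open>k4\<close> and \<open>k3\<close>.\<close>
  let ?w = "k1 *s a + k2 *s b + k3 *s (a \<cdot> c) + k4 *s (b \<cdot> c) + k5 *s e"
  have "?w \<cdot> (b \<cdot> c) = 0" by (simp only: k mult_simps)
  then have k1: "k1 = 0" using e0 by (simp add: mult_simps tab)
  have "?w \<cdot> (a \<cdot> c) = 0" by (simp only: k mult_simps)
  then have k2: "k2 = 0" using e0 by (simp add: mult_simps tab)
  have "a \<cdot> ?w = 0" by (simp only: k mult_simps)
  then have k4: "k4 = 0" using e0 k1 k2 by (simp add: mult_simps tab)
  have "b \<cdot> ?w = 0" by (simp only: k mult_simps)
  then have k3: "k3 = 0" using e0 k1 k2 by (simp add: mult_simps tab)
  show False using k nz e0 k1 k2 k3 k4 by simp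
qed

end

theorem theorem5p3:
  fixes scale :: "complex \<Rightarrow> 'a::ab_group_add \<Rightarrow> 'a"
    and mult :: "'a \<Rightarrow> 'a \<Rightarrow> 'a"
    and Basis :: "'a set"
    and \<delta> :: complex
  assumes "\<delta> \<noteq> 0"
    and "nonassoc_algebra scale mult"
    and "finite_dimensional_vector_space scale Basis"
    and "vector_space.dim scale (UNIV :: 'a set) \<le> 4"
  shows "nonassoc_algebra.mock_novikov scale mult \<delta> \<longleftrightarrow>
         nonassoc_algebra.square scale mult \<subseteq> nonassoc_algebra.annihilator mult"
proof -
  interpret finite_dimensional_nonassoc_algebra scale mult Basis
    using assms(2,3) by (rule finite_dimensional_nonassoc_algebra.intro)
  show ?thesis
  proof
    assume mock: "mock_novikov \<delta>"
    then have "mult (mult a b) c = 0" for a b c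
      using left_triple_product_zero assms(4) by simp
    moreover from this have "mult a (mult b c) = 0" for a b c
      using right_triple_product_zero assms(4) mock by simp
    ultimately show "square \<subseteq> annihilator"
      by (simp add: square_subset_annihilator_iff)
  next
    assume "square \<subseteq> annihilator"
    then show "mock_novikov \<delta>"
      by (simp add: square_subset_annihilator_iff mock_novikov_def)
  qed
qed

end
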